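(* Let $h=r_0-r_f>0$ and suppose the CPT exponents satisfy $\alpha_+=\alpha_-=\alpha$. Define $$\underline G(t)=\min_{1\le k\le K}V_{\rm CPT}^{\widehat P_k}(-1+t\eta_k),\qquad t\ge0.$$ Then, for $c\ge0$, $$\underline\Gamma_h(c):=\min_{1\le k\le K}V_{\rm CPT}^{\widehat P_k}(-h+c\,\eta_k)=h^\alpha\,\underline G\!\left(\frac ch\right),$$ and consequently the robust optimal exposure $c_{\rm DR}^*(h)\in\arg\max_{0\le c\le c_{\max}}\underline\Gamma_h(c)$ satisfies $$\frac{c_{\rm DR}^*(h)}h\in\arg\max_{0\le t\le c_{\max}/h}\underline G(t).$$ If $\underline G$ is nondecreasing on $[0,t_{\rm DR}^*]$, nonincreasing on $[t_{\rm DR}^*,\infty)$, and has the unique maximizer $t_{\rm DR}^*$, then $$c_{\rm DR}^*(h)=\min\{h\,t_{\rm DR}^*,\,c_{\max}\}.$$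
   Context: $\widehat P_1,\dots,\widehat P_K$ are finitely many fitted laws (normal mean-variance mixtures) of a return vector in $\mathbb R^d$; $r_f\in\mathbb R$ is the risk-free return and $r_0\in\mathbb R$ the reference return; $q_0\in\mathbb R^d$ is a fixed nonzero portfolio direction common to all $k$; $\eta_k=q_0^\top(X^{(k)}-r_f\mathbf 1)$ with $X^{(k)}\sim\widehat P_k$ is the projected excess return, a real random variable; $\mathbf 1$ is the all-ones vector; $c\ge0$ is the exposure of the portfolio $cq_0$, and $0<c_{\max}<\infty$ is the exposure bound, $c_{\max}=L/\|q_0\|_1$ for a gross-exposure bound $L>0$. Cumulative prospect (CPT) value. Parameters: $0<\alpha_+,\alpha_-\le 1$, $\lambda_\ell>1$, $\delta_+,\delta_->0$. Value functions for $y\ge0$: $u_+(y)=y^{\alpha_+}$ (gains), $u_-(y)=\lambda_\ell y^{\alpha_-}$ (losses). Probability weighting functions: $w^\pm(p)=p^{\delta_\pm}/[p^{\delta_\pm}+(1-p)^{\delta_\pm}]^{1/\delta_\pm}$ for $0\le p\le1$. For a real random variable $Y$ with continuous distribution function $F_Y$, $$V_{\rm CPT}(Y)=\int_0^\infty u_+(y)\,\mathrm d\{-w^+[1-F_Y(y)]\}-\int_{-\infty}^0u_-(-y)\,\mathrm d\{w^-[F_Y(y)]\}.$$ For a general law it is given by the tail-integral form $$V_{\rm CPT}(Y)=\alpha_+\int_0^\infty y^{\alpha_+-1}w^+\{\Pr[Y>y]\}\,\mathrm dy-\lambda_\ell\alpha_-\int_0^\infty y^{\alpha_--1}w^-\{\Pr[Y<-y]\}\,\mathrm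 dy .$$ $V_{\rm CPT}^{P}$ denotes the CPT value computed under the law $P$. All CPT values appearing in the statement are assumed finite.
   Formalization: If c_max < h t*, G may be constant just below c_max/h and the maximizer is then not unique; the formal claim is that min{h t*, c_max} is optimal and any other optimal c lies below c_max with G constant on [c/h, c_max/h]. *)

theory Defs
  imports "HOL-Probability.Probability"
begin

text \<open>
  The law of \<open>\<mu> + W \<gamma> + \<surd>W A Z\<close> with \<open>W \<ge> 0\<close> a mixing variable of law
  \<open>\<rho>\<close>, independent of a standard normal vector \<open>Z\<close>. A square \<open>A\<close> loses
  nothing: only the dispersion matrix \<open>A A\<^sup>T\<close> matters, and every positive semidefinite
  matrix has this form. Singular \<open>A\<close> and mass of \<open>W\<close> at \<open>0\<close> are allowed.
\<close>

definition std_normal_vec :: "(real ^ 'd) measure" where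
  "std_normal_vec = density lborel (\<lambda>z. ennreal (\<Prod>i\<in>UNIV. std_normal_density (z $ i)))"

definition normal_mean_variance_mixture :: "(real ^ 'd) measure \<Rightarrow> bool" where
  "normal_mean_variance_mixture P \<longleftrightarrow>
     (\<exists>(\<mu> :: real ^ 'd) (\<gamma> :: real ^ 'd) (A :: real ^ 'd ^ 'd) (\<rho> :: real measure).
        prob_space \<rho> \<and> sets \<rho> = sets borel \<and> (AE w in \<rho>. 0 \<le> w) \<and>
        P = distr (\<rho> \<Otimes>\<^sub>M std_normal_vec) borel
              (\<lambda>(w, z). \<mu> + w *\<^sub>R \<gamma> + sqrt w *\<^sub>R (A *v z)))"

definition excess_return :: "real ^ 'd \<Rightarrow> real \<Rightarrow> real ^ 'd \<Rightarrow> real" where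
  "excess_return q rf x = q \<bullet> (x - (\<chi> i. rf))"

definition prob_weight :: "real \<Rightarrow> real \<Rightarrow> real" where
  "prob_weight \<delta> p = p powr \<delta> / (p powr \<delta> + (1 - p) powr \<delta>) powr (1 / \<delta>)"

definition cpt_gain_integrand ::
  "real \<Rightarrow> real \<Rightarrow> 'a measure \<Rightarrow> ('a \<Rightarrow> real) \<Rightarrow> real \<Rightarrow> real" where
  "cpt_gain_integrand \<alpha>\<^sub>p \<delta>\<^sub>p P Y y =
     y powr (\<alpha>\<^sub>p - 1) * prob_weight \<delta>\<^sub>p (measure P {x \<in> space P. Y x > y})"

definition cpt_loss_integrand ::
  "real \<Rightarrow> real \<Rightarrow> 'a measure \<Rightarrow> ('a \<Rightarrow> real) \<Rightarrow> real \<Rightarrow> real" where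
  "cpt_loss_integrand \<alpha>\<^sub>m \<delta>\<^sub>m P Y y =
     y powr (\<alpha>\<^sub>m - 1) * prob_weight \<delta>\<^sub>m (measure P {x \<in> space P. Y x < - y})"

text \<open>
  The CPT value of \<open>Y\<close> under \<open>P\<close>, in the tail-integral form valid for laws with or
  without atoms; subscripts \<open>p\<close> and \<open>m\<close> refer to gains and losses.
  The Bochner integral of a non-integrable function is \<open>0\<close>, so \<open>cpt_value\<close> is the
  intended number only under \<open>cpt_finite\<close>. Both integrands are nonnegative, so integrability
  is finiteness of each of the two integrals.
\<close>

definition cpt_value ::
  "real \<Rightarrow> real \<Rightarrow> real \<Rightarrow> real \<Rightarrow> real \<Rightarrow> 'a measure \<Rightarrow> ('a \<Rightarrow> real) \<Rightarrow> real" where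
  "cpt_value \<alpha>\<^sub>p \<alpha>\<^sub>m lam \<delta>\<^sub>p \<delta>\<^sub>m P Y =
     \<alpha>\<^sub>p * (LINT y:{0<..}|lborel. cpt_gain_integrand \<alpha>\<^sub>p \<delta>\<^sub>p P Y y)
     - lam * \<alpha>\<^sub>m * (LINT y:{0<..}|lborel. cpt_loss_integrand \<alpha>\<^sub>m \<delta>\<^sub>m P Y y)"

definition cpt_finite ::
  "real \<Rightarrow> real \<Rightarrow> real \<Rightarrow> real \<Rightarrow> 'a measure \<Rightarrow> ('a \<Rightarrow> real) \<Rightarrow> bool" where
  "cpt_finite \<alpha>\<^sub>p \<alpha>\<^sub>m \<delta>\<^sub>p \<delta>\<^sub>m P Y \<longleftrightarrow>
     set_integrable lborel {0<..} (cpt_gain_integrand \<alpha>\<^sub>p \<delta>\<^sub>p P Y) \<and>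
     set_integrable lborel {0<..} (cpt_loss_integrand \<alpha>\<^sub>m \<delta>\<^sub>m P Y)"

end

theory Submission
  imports Defs
begin

text \<open>
  The substitution \<open>y = h u\<close> in the two tail integrals shows that the CPT value with a common
  exponent \<open>\<alpha>\<close> is positively homogeneous of degree \<open>\<alpha>\<close>. As
  \<open>-h + c \<eta> = h (-1 + (c / h) \<eta>)\<close>, the factor \<open>h powr \<alpha>\<close> comes out of the minimum over the laws,
  and the optimisation in \<open>c\<close> becomes the one in \<open>t = c / h\<close>. If the peak of \<open>G\<close> lies beyond the bound
  \<open>cmax / h\<close>, monotonicity before the peak makes the bound optimal, but other maximizers
  may exist when \<open>G\<close> is constant just before the bound.
\<close>

text \<open>Dilation by a positive \<open>h\<close> maps the half-line onto itself and contributes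
  the Jacobian \<open>h\<close>. If \<open>f\<close> is not integrable there, neither is its
  rescaling, and both sides are the default value 0.\<close>

lemma set_integral_Ioi_scale:
  fixes f :: "real \<Rightarrow> real"
  assumes "0 < h"
  shows "(LINT y:{0<..}|lborel. f y) = h * (LINT u:{0<..}|lborel. f (h * u))"
proof -
  have "(LINT y:{0<..}|lborel. f y) = h * (LINT u|lborel. indicator {0<..} (h * u) * f (h * u))"
    using lborel_integral_real_affine[of h "\<lambda>y. indicator {0<..} y * f y" 0] assms
    by (simp add: set_lebesgue_integral_def)
  also have "(\<lambda>u. indicator {0<..} (h * u) * f (h * u)) = (\<lambda>u. indicator {0<..} u * f (h * u))"
    using assms by (auto simp: indicator_def zero_less_mult_iff)
  finally show ?thesis
    by (simp add: set_lebesgue_integral_def)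
qed

text \<open>The events \<open>h * Y x > h * u\<close> and \<open>Y x > u\<close> coincide, so only
  the power changes, by \<open>h powr (\<alpha> - 1)\<close>. The \<open>h\<close> in front is the
  Jacobian of the substitution and completes this to \<open>h powr \<alpha>\<close>.\<close>

lemma cpt_gain_integrand_scale:
  assumes "0 < h" "0 < u"
  shows "h * cpt_gain_integrand \<alpha> \<delta> P (\<lambda>x. h * Y x) (h * u)
       = h powr \<alpha> * cpt_gain_integrand \<alpha> \<delta> P Y u"
  using assms by (simp add: cpt_gain_integrand_def powr_mult powr_diff)

lemma cpt_loss_integrand_scale:
  assumes "0 < h" "0 < u"
  shows "h * cpt_loss_integrand \<alpha> \<delta> P (\<lambda>x. h * Y x) (h * u)
       = h powr \<alpha> * cpt_loss_integrand \<alpha> \<delta> P Y u"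
proof -
  have "h * Y x < - (h * u) \<longleftrightarrow> Y x < - u" for x
    using mult_less_cancel_left_pos[OF assms(1), of "Y x" "- u"] by simp
  then show ?thesis
    using assms by (simp add: cpt_loss_integrand_def powr_mult powr_diff)
qed

lemma set_integral_Ioi_scale_homogeneous:
  fixes f g :: "real \<Rightarrow> real"
  assumes "0 < h" and "\<And>u. 0 < u \<Longrightarrow> h * f (h * u) = a * g u"
  shows "(LINT y:{0<..}|lborel. f y) = a * (LINT u:{0<..}|lborel. g u)"
proof -
  have "(LINT y:{0<..}|lborel. f y) = (LINT u:{0<..}|lborel. h * f (h * u))"
    using set_integral_Ioi_scale[OF assms(1), of f] by simp
  also have "\<dots> = (LINT u:{0<..}|lborel. a * g u)"
    by (rule set_lebesgue_integral_cong) (auto simp: assms(2))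
  finally show ?thesis by simp
qed

text \<open>The shared exponent matters here: with two exponents, the gain and loss integrals would
  scale by different powers of \<open>h\<close>, and no single factor would come out of their
  difference.\<close>

lemma cpt_value_scale:
  assumes "0 < h"
  shows "cpt_value \<alpha> \<alpha> lam \<delta>\<^sub>p \<delta>\<^sub>m P (\<lambda>x. h * Y x)
       = h powr \<alpha> * cpt_value \<alpha> \<alpha> lam \<delta>\<^sub>p \<delta>\<^sub>m P Y"
proof -
  have "(LINT y:{0<..}|lborel. cpt_gain_integrand \<alpha> \<delta>\<^sub>p P (\<lambda>x. h * Y x) y)
      = h powr \<alpha> * (LINT u:{0<..}|lborel. cpt_gain_integrand \<alpha> \<delta>\<^sub>p P Y u)"
    by (rule set_integral_Ioi_scale_homogeneous[OF assms])
      (rule cpt_gain_integrand_scale[OF assms])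
  moreover have "(LINT y:{0<..}|lborel. cpt_loss_integrand \<alpha> \<delta>\<^sub>m P (\<lambda>x. h * Y x) y)
      = h powr \<alpha> * (LINT u:{0<..}|lborel. cpt_loss_integrand \<alpha> \<delta>\<^sub>m P Y u)"
    by (rule set_integral_Ioi_scale_homogeneous[OF assms])
      (rule cpt_loss_integrand_scale[OF assms])
  ultimately show ?thesis
    by (simp add: cpt_value_def algebra_simps)
qed

lemma Min_image_mult_left:
  fixes f :: "'a \<Rightarrow> real"
  assumes "finite A" "A \<noteq> {}" "0 \<le> a"
  shows "(MIN k\<in>A. a * f k) = a * (MIN k\<in>A. f k)"
proof -
  have "mono ((*) a)"
    using assms(3) by (simp add: mono_def mult_left_mono)
  then show ?thesis
    using mono_Min_commute[of "(*) a" "f ` A"] assms by (simp add: image_image)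
qed

text \<open>Division by \<open>h\<close> is a bijection between the two feasible intervals, and the
  positive factor \<open>a\<close> preserves every comparison of values.\<close>

lemma is_arg_max_scale_iff:
  fixes F G :: "real \<Rightarrow> real"
  assumes "0 < h" "0 < a" and F: "\<And>c. 0 \<le> c \<Longrightarrow> F c = a * G (c / h)"
  shows "is_arg_max F (\<lambda>c. 0 \<le> c \<and> c \<le> b) c
     \<longleftrightarrow> is_arg_max G (\<lambda>t. 0 \<le> t \<and> t \<le> b / h) (c / h)"
proof -
  have range: "0 \<le> c \<and> c \<le> b \<longleftrightarrow> 0 \<le> c / h \<and> c / h \<le> b / h" for c
    using assms(1) by (auto simp: divide_simps)
  have "(\<forall>y. 0 \<le> y \<and> y \<le> b \<longrightarrow> F y \<le> F c) \<longleftrightarrow>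
        (\<forall>t. 0 \<le> t \<and> t \<le> b / h \<longrightarrow> G t \<le> G (c / h))" if "0 \<le> c"
  proof (intro iffI allI impI)
    \<comment> \<open>The competitor \<open>t\<close> is the image of the exposure
      \<open>h * t\<close>, against which \<open>c\<close> is known to be optimal.\<close>
    fix t assume *: "\<forall>y. 0 \<le> y \<and> y \<le> b \<longrightarrow> F y \<le> F c" "0 \<le> t \<and> t \<le> b / h"
    then show "G t \<le> G (c / h)"
      using range[of "h * t"] F[of "h * t"] F[OF that] assms(1,2)
      by (metis mult_le_cancel_left_pos nonzero_mult_div_cancel_left order_less_irrefl)
  next
    fix y assume "\<forall>t. 0 \<le> t \<and> t \<le> b / h \<longrightarrow> G t \<le> G (c / h)" "0 \<le> y \<and> y \<le> b"
    then show "F y \<le> F c"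
      using range[of y] F[of y] F[OF that] assms(2) by auto
  qed
  then show ?thesis
    using range[of c] by (auto simp: is_arg_max_linorder)
qed

text \<open>If \<open>s \<le> T\<close>, the global maximizer is feasible. Otherwise the whole
  feasible interval lies in the range where \<open>G\<close> is nondecreasing, so its right end is
  optimal.\<close>

lemma is_arg_max_min_peak:
  fixes G :: "real \<Rightarrow> real"
  assumes "0 \<le> s" "0 \<le> T" "mono_on {0..s} G" "is_arg_max G (\<lambda>t. 0 \<le> t) s"
  shows "is_arg_max G (\<lambda>t. 0 \<le> t \<and> t \<le> T) (min s T)"
  using assms mono_onD[OF assms(3), of _ T]
  by (auto simp: is_arg_max_linorder min_def)

text \<open>Uniqueness concerns the maximizer on the whole half-line. It passes to the interval only
  when the peak is feasible; a bound below the peak may end a flat stretch of \<open>G\<close>, all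
  of which is then optimal.\<close>

lemma arg_max_below_peak_cases:
  fixes G :: "real \<Rightarrow> real"
  assumes s: "0 \<le> s" and mono: "mono_on {0..s} G"
    and unique: "\<And>t. is_arg_max G (\<lambda>t. 0 \<le> t) t \<longleftrightarrow> t = s"
    and t: "is_arg_max G (\<lambda>t. 0 \<le> t \<and> t \<le> T) t"
  shows "t = min s T \<or> t < T \<and> T < s \<and> (\<forall>u\<in>{t..T}. G u = G T)"
proof (cases "s \<le> T")
  case True
  have max: "is_arg_max G (\<lambda>t. 0 \<le> t) s"
    by (simp add: unique)
  \<comment> \<open>The peak \<open>s\<close> is itself a competitor of \<open>t\<close>, so
    \<open>t\<close> attains the global maximum.\<close>
  have "G s \<le> G t" "0 \<le> t"
    using t s True by (auto simp: is_arg_max_linorder)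
  then have "is_arg_max G (\<lambda>t. 0 \<le> t) t"
    using max by (fastforce simp: is_arg_max_linorder)
  then show ?thesis
    using unique True by simp
next
  case False
  have t': "0 \<le> t" "t \<le> T" "G T \<le> G t"
    using t by (auto simp: is_arg_max_linorder)
  \<comment> \<open>Monotonicity gives \<open>G t \<le> G u \<le> G T\<close>, and optimality of
    \<open>t\<close> closes the chain with \<open>G T \<le> G t\<close>.\<close>
  have "G u = G T" if "u \<in> {t..T}" for u
    using mono_onD[OF mono, of t u] mono_onD[OF mono, of u T] t' that False by force
  moreover have "t = min s T \<or> t < T \<and> T < s"
    using t' False by auto
  ultimately show ?thesis by blast
qed

text \<open>The last alternative describes the only way in which the optimal exposure can differ
  from the closed form. It is excluded when \<open>h * t\<^sub>D\<^sub>R \<le> cmax\<close>, and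
  also when \<open>G\<close> is strictly increasing up to its peak.\<close>

theorem corollary1:
  fixes P :: "nat \<Rightarrow> (real ^ 'd) measure" and K :: nat
    and q0 :: "real ^ 'd" and r0 rf h L cmax :: real
    and \<alpha>\<^sub>p \<alpha>\<^sub>m \<alpha> lam \<delta>\<^sub>p \<delta>\<^sub>m :: real
    and G \<Gamma> :: "real \<Rightarrow> real"
  assumes K: "1 \<le> K"
    and mixture: "\<forall>k\<in>{1..K}. normal_mean_variance_mixture (P k)"
    and q0: "q0 \<noteq> 0"
    and L: "0 < L" and cmax: "cmax = L / (\<Sum>i\<in>UNIV. \<bar>q0 $ i\<bar>)"
    and h: "h = r0 - rf" "0 < h"
    and params: "0 < \<alpha>\<^sub>p" "\<alpha>\<^sub>p \<le> 1" "0 < \<alpha>\<^sub>m" "\<alpha>\<^sub>m \<le> 1" "1 < lam" "0 < \<delta>\<^sub>p" "0 < \<delta>\<^sub>m"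
    and exponents: "\<alpha>\<^sub>p = \<alpha>" "\<alpha>\<^sub>m = \<alpha>"
    and finite_G: "\<forall>k\<in>{1..K}. \<forall>t\<ge>0.
          cpt_finite \<alpha>\<^sub>p \<alpha>\<^sub>m \<delta>\<^sub>p \<delta>\<^sub>m (P k) (\<lambda>x. - 1 + t * excess_return q0 rf x)"
    and finite_\<Gamma>: "\<forall>k\<in>{1..K}. \<forall>c\<ge>0.
          cpt_finite \<alpha>\<^sub>p \<alpha>\<^sub>m \<delta>\<^sub>p \<delta>\<^sub>m (P k) (\<lambda>x. - h + c * excess_return q0 rf x)"
    and G: "\<forall>t\<ge>0. G t =
          (MIN k\<in>{1..K}. cpt_value \<alpha>\<^sub>p \<alpha>\<^sub>m lam \<delta>\<^sub>p \<delta>\<^sub>m (P k) (\<lambda>x. - 1 + t * excess_return q0 rf x))"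
    and \<Gamma>: "\<forall>c\<ge>0. \<Gamma> c =
          (MIN k\<in>{1..K}. cpt_value \<alpha>\<^sub>p \<alpha>\<^sub>m lam \<delta>\<^sub>p \<delta>\<^sub>m (P k) (\<lambda>x. - h + c * excess_return q0 rf x))"
  shows "(\<forall>c\<ge>0. \<Gamma> c = h powr \<alpha> * G (c / h))
    \<and> (\<forall>c. is_arg_max \<Gamma> (\<lambda>c. 0 \<le> c \<and> c \<le> cmax) c \<longrightarrow>
           is_arg_max G (\<lambda>t. 0 \<le> t \<and> t \<le> cmax / h) (c / h))
    \<and> (\<forall>t\<^sub>D\<^sub>R. 0 \<le> t\<^sub>D\<^sub>R \<and> mono_on {0..t\<^sub>D\<^sub>R} G \<and> antimono_on {t\<^sub>D\<^sub>R..} G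
           \<and> (\<forall>t. is_arg_max G (\<lambda>t. 0 \<le> t) t \<longleftrightarrow> t = t\<^sub>D\<^sub>R) \<longrightarrow>
         is_arg_max \<Gamma> (\<lambda>c. 0 \<le> c \<and> c \<le> cmax) (min (h * t\<^sub>D\<^sub>R) cmax)
         \<and> (\<forall>c. is_arg_max \<Gamma> (\<lambda>c. 0 \<le> c \<and> c \<le> cmax) c \<longrightarrow>
              c = min (h * t\<^sub>D\<^sub>R) cmax
              \<or> c < cmax \<and> cmax < h * t\<^sub>D\<^sub>R \<and> (\<forall>t\<in>{c / h..cmax / h}. G t = G (cmax / h))))"
proof -
  define T where "T = cmax / h"
  have scale: "\<Gamma> c = h powr \<alpha> * G (c / h)" if "0 \<le> c" for c
  proof -
    have "(\<lambda>x. - h + c * excess_return q0 rf x)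
        = (\<lambda>x. h * (- 1 + c / h * excess_return q0 rf x))"
      using h(2) by (auto simp: field_simps)
    then have "\<Gamma> c = (MIN k\<in>{1..K}. h powr \<alpha> *
        cpt_value \<alpha> \<alpha> lam \<delta>\<^sub>p \<delta>\<^sub>m (P k) (\<lambda>x. - 1 + c / h * excess_return q0 rf x))"
      using \<Gamma> that by (simp only: exponents cpt_value_scale[OF h(2)])
    also have "\<dots> = h powr \<alpha> * G (c / h)"
      using G that h(2) K by (simp add: Min_image_mult_left exponents)
    finally show ?thesis .
  qed
  \<comment> \<open>Both directions serve: one sends optimal exposures to maximizers of
    \<open>G\<close>, the other carries the capped peak of \<open>G\<close> back to an optimal
    exposure.\<close>
  have iff: "is_arg_max \<Gamma> (\<lambda>c. 0 \<le> c \<and> c \<le> cmax) c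
      \<longleftrightarrow> is_arg_max G (\<lambda>t. 0 \<le> t \<and> t \<le> T) (c / h)" for c
    unfolding T_def using h(2) scale by (intro is_arg_max_scale_iff[where a = "h powr \<alpha>"]) auto
  \<comment> \<open>A nonnegative bound keeps the capped peak \<open>min s T\<close> inside the
    feasible interval.\<close>
  have "0 \<le> cmax"
    using L by (simp add: cmax sum_nonneg)
  then have T: "0 \<le> T"
    using h(2) by (simp add: T_def)
  have min: "min (h * s) cmax / h = min s T" for s
    using h(2) by (auto simp: T_def min_def field_simps)
  have peak: "is_arg_max \<Gamma> (\<lambda>c. 0 \<le> c \<and> c \<le> cmax) (min (h * s) cmax)
         \<and> (\<forall>c. is_arg_max \<Gamma> (\<lambda>c. 0 \<le> c \<and> c \<le> cmax) c \<longrightarrow>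
              c = min (h * s) cmax
              \<or> c < cmax \<and> cmax < h * s \<and> (\<forall>t\<in>{c / h..cmax / h}. G t = G (cmax / h)))"
    if s: "0 \<le> s" "mono_on {0..s} G" and unique: "\<And>t. is_arg_max G (\<lambda>t. 0 \<le> t) t \<longleftrightarrow> t = s" for s
  proof (intro conjI allI impI)
    show "is_arg_max \<Gamma> (\<lambda>c. 0 \<le> c \<and> c \<le> cmax) (min (h * s) cmax)"
      unfolding iff min using s T unique by (intro is_arg_max_min_peak) auto
  next
    fix c assume "is_arg_max \<Gamma> (\<lambda>c. 0 \<le> c \<and> c \<le> cmax) c"
    then have "c / h = min s T \<or> c / h < T \<and> T < s \<and> (\<forall>u\<in>{c / h..T}. G u = G T)"
      unfolding iff using s unique by (intro arg_max_below_peak_cases)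
    moreover have "c / h = min s T \<longleftrightarrow> c = min (h * s) cmax"
      unfolding min[symmetric] using h(2) by simp
    moreover have "c / h < T \<longleftrightarrow> c < cmax" "T < s \<longleftrightarrow> cmax < h * s"
      using h(2) by (auto simp: T_def field_simps)
    ultimately show "c = min (h * s) cmax
        \<or> c < cmax \<and> cmax < h * s \<and> (\<forall>t\<in>{c / h..cmax / h}. G t = G (cmax / h))"
      by (simp add: T_def)
  qed
  show ?thesis
  proof (intro conjI)
    show "\<forall>c\<ge>0. \<Gamma> c = h powr \<alpha> * G (c / h)"
      using scale by blast
    show "\<forall>c. is_arg_max \<Gamma> (\<lambda>c. 0 \<le> c \<and> c \<le> cmax) c \<longrightarrow>
        is_arg_max G (\<lambda>t. 0 \<le> t \<and> t \<le> cmax / h) (c / h)"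
      using iff unfolding T_def by blast
  qed (use peak in blast)
qed

end
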